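(* Let $A=\{a_0<a_1<a_2<\dots<a_{k-1}\}\subset\mathbb{Z}$ be a finite set of integers of size $k=|A|\ge 1$. Then the following statements hold. (a) If $1\le k\le 2$, then $|A+2\ast A|=3k-2$ and $A$ is an arithmetic progression of size $k$. (b) If $k\ge 3$, assume that $$|A+2\ast A|=(3k-2)+h<4k-4.$$ Then $h\ge 0$, $|A+2\ast A|\ge 3k-2$, and the set $A$ is a subset of an arithmetic progression $$P=\{a_0,a_0+d,a_0+2d,\dots,a_0+(l-1)d\}$$ of size $|P|$ bounded by $$|P|\le k+h=|A+2\ast A|-2k+2\le 2k-3.$$ (c) If $k\ge 1$ and $|A+2\ast A|=3k-2$, then $A$ is an arithmetic progression $$A=\{a_0,a_0+d,a_0+2d,\dots,a_0+(k-1)d\}.$$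
   Context: For a positive integer $r$ and a finite set $A\subseteq\mathbb{Z}$, $r\ast A=\{rx: x\in A\}$, and $A+2\ast A=\{x+2y: x,y\in A\}$. $|X|$ denotes the size of a finite set $X$. In arithmetic progressions the common difference $d$ is some positive integer; a one-element set is an arithmetic progression of size $1$. In (b), $h$ is the integer defined by $h=|A+2\ast A|-(3k-2)$. *)

theory Defs
  imports Main "HOL-Library.Set_Algebras"
begin

text \<open>
  \<open>A + 2 *o A\<close>, in the notation of \<open>Set_Algebras\<close>, is the set of all \<open>x + 2 * y\<close> with
  \<open>x\<close> and \<open>y\<close> in \<open>A\<close>.
\<close>

definition arith_prog :: "int \<Rightarrow> int \<Rightarrow> nat \<Rightarrow> int set" where
  "arith_prog b d l = (\<lambda>i. b + int i * d) ` {..<l}"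

text \<open>As \<open>d > 0\<close>, the \<open>l\<close> terms are distinct, so \<open>l\<close> is indeed the size of \<open>A\<close>.\<close>

definition is_arith_prog_of_size :: "int set \<Rightarrow> nat \<Rightarrow> bool" where
  "is_arith_prog_of_size A l \<longleftrightarrow> (\<exists>b d. d > 0 \<and> A = arith_prog b d l)"

end

theory Submission
  imports Complex_Main Defs
begin

text \<open>
  Normalise so that \<open>0 \<in> A\<close>, \<open>l = Max A\<close> and \<open>Gcd A = 1\<close>. Splitting \<open>A + 2 *o A\<close> by the parity of
  the first summand gives \<open>|A + 2 *o A| = |A + B\<^sub>0| + |A + B\<^sub>1|\<close>, where \<open>B\<^sub>0\<close> and \<open>B\<^sub>1\<close>, both
  nonempty, are the halves (rounded down) of the even and of the odd elements of \<open>A\<close>. The trivial bound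
  \<open>|X + Y| \<ge> |X| + |Y| - 1\<close> yields \<open>3k - 2\<close>. By the theorem of Lev and Smeliansky,
  \<open>|A + B\<^sub>i| \<ge> min (l + |B\<^sub>i|) (k + 2|B\<^sub>i| - 2)\<close>. If the second term is the bound for both \<open>i\<close>, then
  \<open>|A + 2 *o A| \<ge> 4k - 4\<close>; otherwise \<open>|A + 2 *o A| \<ge> l + 2k - 1\<close>, which bounds the length \<open>l + 1\<close>
  of the progression.

  Lev--Smeliansky follows from Kneser's theorem in the integers modulo \<open>l\<close>, where \<open>0\<close> and \<open>l\<close>
  become equal, so that every element of \<open>B\<close> accounts for two elements of \<open>A + B\<close>. Kneser's
  theorem is proved by his original argument: Dyson transforms cover \<open>A + B\<close> by sets satisfying
  the claimed inequality, and the inequality is preserved under unions.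
\<close>

section \<open>Kneser's theorem\<close>

definition add_subgroup :: "'a::ab_group_add set \<Rightarrow> bool" where
  "add_subgroup H \<longleftrightarrow> 0 \<in> H \<and> (\<forall>x\<in>H. \<forall>y\<in>H. x - y \<in> H)"

text \<open>The group of periods of \<open>X\<close>. The equivalence, rather than one implication,
  makes it a subgroup even for infinite \<open>X\<close>; for finite \<open>X\<close>,
  \<open>closed_imp_stab\<close> recovers it from one implication.\<close>

definition stab :: "'a::ab_group_add set \<Rightarrow> 'a set" where
  "stab X = {h. \<forall>x. h + x \<in> X \<longleftrightarrow> x \<in> X}"

lemma add_subgroup_zero: "add_subgroup H \<Longrightarrow> 0 \<in> H"
  by (simp add: add_subgroup_def)

lemma add_subgroup_diff: "add_subgroup H \<Longrightarrow> x \<in> H \<Longrightarrow> y \<in> H \<Longrightarrow> x - y \<in> H"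
  by (simp add: add_subgroup_def)

lemma add_subgroup_uminus: "add_subgroup H \<Longrightarrow> x \<in> H \<Longrightarrow> - x \<in> H"
  using add_subgroup_diff[of H 0 x] by (simp add: add_subgroup_zero)

lemma add_subgroup_add: "add_subgroup H \<Longrightarrow> x \<in> H \<Longrightarrow> y \<in> H \<Longrightarrow> x + y \<in> H"
  using add_subgroup_diff[of H x "- y"] by (simp add: add_subgroup_uminus)

lemma add_subgroup_set_plus:
  assumes "add_subgroup H" "add_subgroup K"
  shows "add_subgroup (H + K)"
  unfolding add_subgroup_def
proof (intro conjI ballI)
  show "0 \<in> H + K"
    using set_plus_intro[of 0 H 0 K] assms by (simp add: add_subgroup_zero)
next
  fix x y assume "x \<in> H + K" "y \<in> H + K"
  then obtain a b c d where "a \<in> H" "b \<in> K" "c \<in> H" "d \<in> K" "x = a + b" "y = c + d"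
    by (elim set_plus_elim) blast
  then have eq: "x - y = (a - c) + (b - d)" and "a - c \<in> H" "b - d \<in> K"
    using assms by (auto simp: algebra_simps add_subgroup_diff)
  then show "x - y \<in> H + K" unfolding eq by blast
qed

lemma add_subgroup_Int: "add_subgroup H \<Longrightarrow> add_subgroup K \<Longrightarrow> add_subgroup (H \<inter> K)"
  by (simp add: add_subgroup_def)

lemma add_subgroup_plus_self: "add_subgroup H \<Longrightarrow> H + H = H"
  using set_zero_plus2[of H H] by (auto simp: add_subgroup_zero add_subgroup_add elim: set_plus_elim)

lemma stabD: "h \<in> stab X \<Longrightarrow> h + x \<in> X \<longleftrightarrow> x \<in> X"
  by (simp add: stab_def)

lemma stabD2: "h \<in> stab X \<Longrightarrow> x + h \<in> X \<longleftrightarrow> x \<in> X"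
  using stabD[of h X x] by (simp add: add.commute)

lemma add_subgroup_stab: "add_subgroup (stab X)"
  unfolding add_subgroup_def
proof (intro conjI ballI)
  show "0 \<in> stab X" by (simp add: stab_def)
next
  fix h k assume "h \<in> stab X" "k \<in> stab X"
  then have "h - k + x \<in> X \<longleftrightarrow> x \<in> X" for x
    using stabD[of h X "x - k"] stabD[of k X "x - k"] by (simp add: algebra_simps)
  then show "h - k \<in> stab X" by (simp add: stab_def)
qed

lemma stab_plus: "X + stab X = X"
  using set_zero_plus2[OF add_subgroup_zero[OF add_subgroup_stab], of X X]
  by (auto simp: stabD2 add.commute elim: set_plus_elim)

text \<open>Adding a fixed element of \<open>X\<close> embeds \<open>stab X\<close> into
  \<open>X\<close>. The empty set is excluded because every group element stabilises it.\<close>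

lemma finite_stab: "finite X \<Longrightarrow> X \<noteq> {} \<Longrightarrow> finite (stab X)"
proof -
  assume X: "finite X" "X \<noteq> {}"
  then obtain c where "c \<in> X" by blast
  then have "(\<lambda>h. h + c) ` stab X \<subseteq> X" by (auto simp: stabD)
  then have "finite ((\<lambda>h. h + c) ` stab X)" using X finite_subset by blast
  then show ?thesis by (rule finite_imageD) (simp add: inj_on_def)
qed

lemma card_elt_set_plus: "card (c +o H) = card H" for c :: "'a::ab_group_add"
proof -
  have "c +o H = (+) c ` H" by (auto simp: elt_set_plus_def)
  then show ?thesis by (simp add: card_image)
qed

lemma finite_elt_set_plus: "finite H \<Longrightarrow> finite (c +o H)" for c :: "'a::ab_group_add"
proof -
  have "c +o H = (+) c ` H" by (auto simp: elt_set_plus_def)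
  then show "finite H \<Longrightarrow> finite (c +o H)" by simp
qed

lemma mem_elt_set_plus: "x \<in> c +o H \<longleftrightarrow> x - c \<in> H" for c :: "'a::ab_group_add"
  by (simp add: set_minus_plus)

lemma coset_subset: "H \<subseteq> stab X \<Longrightarrow> c \<in> X \<Longrightarrow> c +o H \<subseteq> X"
  by (auto simp: elt_set_plus_def stabD2)

lemma subset_stab_coset: "add_subgroup M \<Longrightarrow> H \<subseteq> M \<Longrightarrow> H \<subseteq> stab (c +o M)"
proof
  fix h assume M: "add_subgroup M" and "H \<subseteq> M" "h \<in> H"
  then have h: "h \<in> M" by blast
  have "h + x - c \<in> M \<longleftrightarrow> x - c \<in> M" for x
  proof
    assume "h + x - c \<in> M"
    from add_subgroup_diff[OF M this h] show "x - c \<in> M" by simp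
  next
    assume "x - c \<in> M"
    from add_subgroup_add[OF M h this] show "h + x - c \<in> M" by (simp add: algebra_simps)
  qed
  then show "h \<in> stab (c +o M)" by (simp add: stab_def mem_elt_set_plus)
qed

lemma subset_stab_Diff: "H \<subseteq> stab X \<Longrightarrow> H \<subseteq> stab Y \<Longrightarrow> H \<subseteq> stab (X - Y)"
  by (auto simp: stab_def)

lemma subset_stab_Int: "H \<subseteq> stab X \<Longrightarrow> H \<subseteq> stab Y \<Longrightarrow> H \<subseteq> stab (X \<inter> Y)"
  by (auto simp: stab_def)

section \<open>Counting in periodic sets\<close>

text \<open>\<open>X\<close> is a disjoint union of cosets of \<open>H\<close>; the induction
  removes one coset at a time.\<close>

lemma card_dvd_periodic:
  assumes H: "add_subgroup H" and "finite X" "H \<subseteq> stab X"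
  shows "card H dvd card X"
  using assms(2,3)
proof (induction X rule: finite_psubset_induct)
  case (psubset X)
  show ?case
  proof (cases "X = {}")
    case False
    then obtain c where c: "c \<in> X" by blast
    have sub: "c +o H \<subseteq> X" using psubset.prems c by (rule coset_subset)
    have "c \<in> c +o H" using H by (simp add: mem_elt_set_plus add_subgroup_zero)
    then have ps: "X - (c +o H) \<subset> X" using c by blast
    have "H \<subseteq> stab (X - (c +o H))"
      using psubset.prems subset_stab_coset[OF H order_refl] by (rule subset_stab_Diff)
    then have "card H dvd card (X - (c +o H))" using psubset.IH[OF ps] by blast
    moreover have "card X = card (X - (c +o H)) + card H"
    proof -
      have "card (X - (c +o H)) = card X - card (c +o H)"
        using sub psubset.hyps by (intro card_Diff_subset) (auto intro: finite_subset)
      moreover have "card (c +o H) \<le> card X" using sub psubset.hyps by (intro card_mono)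
      ultimately show ?thesis by (simp add: card_elt_set_plus)
    qed
    ultimately show ?thesis by simp
  qed simp
qed

text \<open>Double counting of the pairs \<open>(x, h)\<close> with \<open>x + h \<in> Z\<close>:
  for fixed \<open>h\<close>, translation by \<open>h\<close> permutes \<open>Y\<close>.\<close>

lemma sum_card_translates:
  assumes H: "finite H" and Y: "finite Y" "H \<subseteq> stab Y"
  shows "(\<Sum>x\<in>Y. card {h\<in>H. x + h \<in> Z}) = card H * card (Y \<inter> Z)"
proof -
  have "(\<Sum>x\<in>Y. card {h\<in>H. x + h \<in> Z}) = (\<Sum>x\<in>Y. \<Sum>h\<in>H. if x + h \<in> Z then 1 else 0)"
    using H by (intro sum.cong refl) (simp add: sum.If_cases Int_def)
  also have "\<dots> = (\<Sum>h\<in>H. \<Sum>x\<in>Y. if x + h \<in> Z then 1 else 0)" by (rule sum.swap)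
  also have "\<dots> = (\<Sum>h\<in>H. card {x\<in>Y. x + h \<in> Z})"
    using Y by (intro sum.cong refl) (simp add: sum.If_cases Int_def)
  also have "\<dots> = (\<Sum>h\<in>H. card (Y \<inter> Z))"
  proof (rule sum.cong[OF refl])
    fix h assume "h \<in> H"
    then have h: "h \<in> stab Y" using Y by blast
    have "x - h \<in> Y" if "x \<in> Y" for x using stabD2[OF h, of "x - h"] that by simp
    then have "bij_betw (\<lambda>x. x + h) {x\<in>Y. x + h \<in> Z} (Y \<inter> Z)"
      by (intro bij_betw_byWitness[where f' = "\<lambda>x. x - h"]) (auto simp: stabD2[OF h])
    then show "card {x\<in>Y. x + h \<in> Z} = card (Y \<inter> Z)" by (rule bij_betw_same_card)
  qed
  finally show ?thesis by simp
qed

text \<open>Inside one coset of \<open>H + K\<close>, an \<open>H\<close>-periodic and a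
  \<open>K\<close>-periodic set are independent, like a union of rows and a union of columns of a
  grid. Counting translates into \<open>Z\<close> from \<open>X\<close> and from the whole coset
  gives two equations, from which the common count \<open>z\<close> is eliminated.\<close>

lemma card_Int_periodic:
  assumes H: "add_subgroup H" "finite H" and K: "add_subgroup K" "finite K"
    and X: "X \<subseteq> c +o (H + K)" "H \<subseteq> stab X"
    and Z: "Z \<subseteq> c +o (H + K)" "K \<subseteq> stab Z"
  shows "card (X \<inter> Z) * card (H + K) = card X * card Z"
proof -
  let ?Q = "c +o (H + K)"
  have M: "add_subgroup (H + K)" "finite (H + K)"
    using H K by (auto simp: add_subgroup_set_plus finite_set_plus)
  have HM: "H \<subseteq> H + K" using set_zero_plus2[of K H] K by (simp add: add_subgroup_zero add.commute)
  have Q: "finite ?Q" "card ?Q = card (H + K)" "H \<subseteq> stab ?Q"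
  proof -
    show "card ?Q = card (H + K)" by (rule card_elt_set_plus)
    show "finite ?Q" using M(2) by (rule finite_elt_set_plus)
    show "H \<subseteq> stab ?Q" using M(1) HM by (rule subset_stab_coset)
  qed
  \<comment> \<open>every coset of \<open>H\<close> in \<open>c +o (H + K)\<close> meets \<open>Z\<close> in the same number of points\<close>
  define z where "z = card {h\<in>H. c + h \<in> Z}"
  have const: "card {h\<in>H. x + h \<in> Z} = z" if "x \<in> ?Q" for x
  proof -
    from that obtain h0 k0 where hk: "h0 \<in> H" "k0 \<in> K" "x = c + (h0 + k0)"
      by (auto simp: elt_set_plus_def elim!: set_plus_elim)
    have eq: "x + h \<in> Z \<longleftrightarrow> c + (h0 + h) \<in> Z" for h
    proof -
      have "k0 \<in> stab Z" using hk(2) Z(2) by blast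
      from stabD[OF this, of "c + (h0 + h)"] show ?thesis by (simp add: hk(3) algebra_simps)
    qed
    have "bij_betw (\<lambda>h. h0 + h) {h\<in>H. x + h \<in> Z} {h\<in>H. c + h \<in> Z}"
      by (rule bij_betw_byWitness[where f' = "\<lambda>h. h - h0"])
        (auto simp: eq H(1) hk(1) add_subgroup_add add_subgroup_diff)
    then show ?thesis unfolding z_def by (rule bij_betw_same_card)
  qed
  have "card H * card (X \<inter> Z) = card X * z"
  proof -
    have "finite X" using Q(1) X(1) by (rule rev_finite_subset)
    moreover have "(\<Sum>x\<in>X. card {h\<in>H. x + h \<in> Z}) = card X * z"
      using X(1) const by (simp add: subset_iff)
    ultimately show ?thesis using sum_card_translates[OF H(2) _ X(2), of Z] by simp
  qed
  moreover have "card H * card Z = card (H + K) * z"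
    using sum_card_translates[OF H(2) Q(1) Q(3), of Z] const Q(2) Z(1)
    by (simp add: Int_absorb1)
  ultimately have "card H * (card (X \<inter> Z) * card (H + K)) = card H * (card X * card Z)"
    by (simp add: mult.assoc [symmetric])
  moreover have "card H > 0" using H add_subgroup_zero by (auto simp: card_gt_0_iff)
  ultimately show ?thesis by simp
qed

text \<open>Translation is injective, so a finite set that it maps into itself is mapped onto
  itself.\<close>

lemma closed_imp_stab:
  assumes X: "finite X" and h: "\<And>x. x \<in> X \<Longrightarrow> h + x \<in> X"
  shows "h \<in> stab X"
proof -
  have "card ((+) h ` X) = card X" by (intro card_image) simp
  then have "(+) h ` X = X" using X h by (intro card_subset_eq) auto
  then have "h + x \<in> X \<longleftrightarrow> x \<in> X" for x by (metis add_left_cancel imageE imageI)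
  then show ?thesis by (simp add: stab_def)
qed

section \<open>Kneser's inequality for unions\<close>

text \<open>Put \<open>v = s - w\<close> and \<open>t = r - u\<close>. Hypothesis \<open>1\<close>
  becomes \<open>(u - 1) * w + 1 < v\<close>, which forces \<open>u < v\<close>; hypothesis
  \<open>2\<close> becomes \<open>t * (v - 1) + 1 < u\<close>, which forces
  \<open>v < u\<close>.\<close>

lemma grid_arith:
  fixes u w r s :: nat
  assumes u: "0 < u" "u < r" and w: "0 < w" "w < s"
    and 1: "u * w + 1 < s" and 2: "(r - u) * (s - w) + 1 < r"
  shows False
proof -
  obtain v where v: "s = w + v" "v > 0" using w less_imp_add_positive by blast
  obtain t where t: "r = u + t" "t > 0" using u less_imp_add_positive by blast
  obtain u' where u': "u = Suc u'" using u gr0_implies_Suc by blast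
  obtain v' where v': "v = Suc v'" using v gr0_implies_Suc by blast
  have "u' * w + 1 < v" using 1 by (simp add: v u')
  moreover have "u' \<le> u' * w" using w by simp
  moreover have "t * v' + 1 < u" using 2 by (simp add: v v' t)
  moreover have "v' \<le> t * v'" using t by simp
  ultimately show False using u' v' by linarith
qed

text \<open>
  A coset \<open>Q\<close> of \<open>stab C + stab D\<close> is a grid whose rows are cosets of \<open>stab C\<close> and whose columns are
  cosets of \<open>stab D\<close>. If \<open>C\<close> misses \<open>u\<close> of the \<open>r\<close> rows and \<open>D\<close> contains \<open>w\<close> of the \<open>s\<close> columns, then
  \<open>D - C\<close> and \<open>C - D\<close> meet \<open>Q\<close> in \<open>u * w\<close> and \<open>(r - u) * (s - w)\<close> cells of size \<open>|stab C \<inter> stab D|\<close>.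
\<close>

lemma kneser_coset:
  fixes C D :: "'a::ab_group_add set"
  assumes C: "finite C" "C \<noteq> {}" and D: "finite D" "D \<noteq> {}"
    and CD: "card (D - C) + card (stab C \<inter> stab D) < card (stab C)"
    and DC: "card (C - D) + card (stab C \<inter> stab D) < card (stab D)"
    and Q: "Q = c +o (stab C + stab D)"
    and "Q \<inter> C \<noteq> {}" "\<not> Q \<subseteq> C" "Q \<inter> D \<noteq> {}" "\<not> Q \<subseteq> D"
  shows False
proof -
  let ?H = "stab C" and ?K = "stab D"
  let ?M = "?H + ?K"
  have H: "add_subgroup ?H" "finite ?H" and K: "add_subgroup ?K" "finite ?K"
    using C D by (auto simp: add_subgroup_stab finite_stab)
  have M: "add_subgroup ?M" "finite ?M" using H K by (auto simp: add_subgroup_set_plus finite_set_plus)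
  have HM: "?H \<subseteq> ?M" using set_zero_plus2[of ?K ?H] K by (simp add: add_subgroup_zero add.commute)
  have KM: "?K \<subseteq> ?M" using set_zero_plus2[of ?H ?K] H by (simp add: add_subgroup_zero)
  have cQ: "card Q = card ?M" unfolding Q by (rule card_elt_set_plus)
  have fQ: "finite Q" unfolding Q using M(2) by (rule finite_elt_set_plus)
  have sQ: "?H \<subseteq> stab Q" "?K \<subseteq> stab Q" unfolding Q using M(1) HM KM by (auto intro: subset_stab_coset[THEN subsetD])
  define h where "h = card ?H"
  define k where "k = card ?K"
  define m where "m = card ?M"
  define n where "n = card (?H \<inter> ?K)"
  have pos: "h > 0" "k > 0" "m > 0" "n > 0"
    unfolding h_def k_def m_def n_def
    using H K M add_subgroup_zero by (auto simp: card_gt_0_iff)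
  \<comment> \<open>Independence applied to the two stabilisers themselves, inside the coset of
    0.\<close>
  have hk: "n * m = h * k"
  proof -
    have "card (?H \<inter> ?K) * card ?M = card ?H * card ?K"
      by (rule card_Int_periodic[where c = 0])
        (use H K HM KM subset_stab_coset[of ?H ?H 0] subset_stab_coset[of ?K ?K 0] in auto)
    then show ?thesis by (simp add: n_def m_def h_def k_def)
  qed
  have dvd: "card ?H dvd card X" if "X \<subseteq> Q" "?H \<subseteq> stab X" for X
    using card_dvd_periodic[OF H(1) _ that(2)] that(1) fQ finite_subset by blast
  have dvd': "card ?K dvd card X" if "X \<subseteq> Q" "?K \<subseteq> stab X" for X
    using card_dvd_periodic[OF K(1) _ that(2)] that(1) fQ finite_subset by blast
  \<comment> \<open>A row consists of \<open>s\<close> cells and a column of \<open>r\<close> cells,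
    each cell of size \<open>n\<close>.\<close>
  have "n dvd h" unfolding n_def h_def
    by (rule card_dvd_periodic) (use H K subset_stab_coset[of ?H "?H \<inter> ?K" 0] in \<open>auto simp: add_subgroup_Int\<close>)
  then obtain s where s: "h = n * s" by blast
  have "n dvd k" unfolding n_def k_def
    by (rule card_dvd_periodic) (use H K subset_stab_coset[of ?K "?H \<inter> ?K" 0] in \<open>auto simp: add_subgroup_Int\<close>)
  then obtain r where r: "k = n * r" by blast
  have m: "m = n * s * r" using hk pos by (simp add: s r)
  have "h dvd card (Q - C)" unfolding h_def
    by (rule dvd) (auto intro: subset_stab_Diff[OF sQ(1) order_refl, THEN subsetD])
  then obtain u where u: "card (Q - C) = h * u" by blast
  have "k dvd card (Q \<inter> D)" unfolding k_def
    by (rule dvd') (auto intro: subset_stab_Int[OF sQ(2) order_refl, THEN subsetD])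
  then obtain w where w: "card (Q \<inter> D) = k * w" by blast
  have mQC: "card (Q \<inter> C) + h * u = m"
    using card_Int_Diff[OF fQ, of C] u cQ by (simp add: m_def)
  have mQD: "k * w + card (Q - D) = m"
    using card_Int_Diff[OF fQ, of D] w cQ by (simp add: m_def)
  have cu: "card (Q \<inter> C) = h * (r - u)"
    using mQC by (simp add: m s[symmetric] diff_mult_distrib2)
  have dw: "card (Q - D) = k * (s - w)"
  proof -
    have "m = k * s" by (simp add: m r)
    then show ?thesis using mQD by (simp add: diff_mult_distrib2)
  qed
  have "card (Q - C) > 0" "card (Q \<inter> D) > 0" "card (Q \<inter> C) > 0" "card (Q - D) > 0"
    using assms(8-11) fQ by (auto simp: card_gt_0_iff)
  then have uw: "0 < u" "u < r" "0 < w" "w < s"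
    unfolding u w cu dw by auto
  \<comment> \<open>Cancelling \<open>m\<close> turns the product formula for an intersection into a
    number of cells times \<open>n\<close>.\<close>
  have eq: "e = a * b * n" if "e * m = (n * s * a) * (n * r * b)" for a b e
  proof -
    have "e * m = (a * b * n) * m" unfolding that by (simp add: m)
    then show ?thesis using pos(3) by simp
  qed
  have "card ((Q - C) \<inter> (Q \<inter> D)) * card ?M = card (Q - C) * card (Q \<inter> D)"
    by (rule card_Int_periodic[OF H K])
      (use Q subset_stab_Diff[OF sQ(1) order_refl] subset_stab_Int[OF sQ(2) order_refl] in auto)
  then have "card ((Q - C) \<inter> (Q \<inter> D)) = u * w * n"
    unfolding u w s r m_def[symmetric] by (rule eq)
  moreover have "card ((Q - C) \<inter> (Q \<inter> D)) \<le> card (D - C)"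
    using D(1) by (intro card_mono) auto
  ultimately have "u * w * n + n < n * s" using CD by (simp add: h_def[symmetric] n_def[symmetric] s)
  then have "n * (u * w + 1) < n * s" by (simp add: algebra_simps)
  then have 1: "u * w + 1 < s" by (rule mult_left_less_imp_less) simp
  have "card ((Q \<inter> C) \<inter> (Q - D)) * card ?M = card (Q \<inter> C) * card (Q - D)"
    by (rule card_Int_periodic[OF H K])
      (use Q subset_stab_Int[OF sQ(1) order_refl] subset_stab_Diff[OF sQ(2) order_refl] in auto)
  then have "card ((Q \<inter> C) \<inter> (Q - D)) = (r - u) * (s - w) * n"
    unfolding cu dw m_def[symmetric] unfolding s r by (rule eq)
  moreover have "card ((Q \<inter> C) \<inter> (Q - D)) \<le> card (C - D)"
    using C(1) by (intro card_mono) auto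
  ultimately have "(r - u) * (s - w) * n + n < n * r" using DC by (simp add: k_def[symmetric] n_def[symmetric] r)
  then have "n * ((r - u) * (s - w) + 1) < n * r" by (simp add: algebra_simps)
  then have 2: "(r - u) * (s - w) + 1 < r" by (rule mult_left_less_imp_less) simp
  show False using grid_arith[OF uw 1 2] .
qed

text \<open>The row \<open>c +o stab C\<close> misses \<open>C\<close> and is too large to fit into
  \<open>D - C\<close>, so the coset \<open>Q\<close> of \<open>c\<close> is not contained in
  \<open>D\<close>. Since \<open>Q\<close> meets \<open>D\<close> at \<open>c\<close>,
  \<open>kneser_coset\<close> leaves only the case that \<open>Q\<close> avoids \<open>C\<close>.
  Then the column \<open>c +o stab D\<close> lies in \<open>D - C\<close>, which is smaller than
  \<open>stab C\<close>.\<close>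

lemma kneser_union_aux:
  fixes C D :: "'a::ab_group_add set"
  assumes C: "finite C" "C \<noteq> {}" and D: "finite D" "D \<noteq> {}"
    and CD: "card (D - C) + card (stab C \<inter> stab D) < card (stab C)"
    and DC: "card (C - D) + card (stab C \<inter> stab D) < card (stab D)"
    and c: "c \<in> D - C"
  shows "card (stab D) < card (stab C)"
proof -
  let ?H = "stab C" and ?K = "stab D"
  define Q where "Q = c +o (?H + ?K)"
  have HM: "?H \<subseteq> ?H + ?K"
    using set_zero_plus2[of ?K ?H] by (simp add: add_subgroup_zero add_subgroup_stab add.commute)
  have KM: "?K \<subseteq> ?H + ?K"
    using set_zero_plus2[of ?H ?K] by (simp add: add_subgroup_zero add_subgroup_stab)
  have "0 \<in> ?H + ?K" using HM add_subgroup_zero[OF add_subgroup_stab] by blast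
  then have cQ: "c \<in> Q" by (simp add: Q_def mem_elt_set_plus)
  have cH: "c +o ?H \<subseteq> Q - C"
  proof -
    have "(c +o ?H) \<inter> C = {}" using c by (auto simp: elt_set_plus_def stabD2)
    moreover have "c +o ?H \<subseteq> Q" unfolding Q_def using HM by (rule set_plus_mono)
    ultimately show ?thesis by blast
  qed
  have "\<not> Q \<subseteq> D"
  proof
    assume "Q \<subseteq> D"
    then have "card (c +o ?H) \<le> card (D - C)" using cH D(1) by (intro card_mono) auto
    then show False using CD by (simp add: card_elt_set_plus)
  qed
  then have QC: "Q \<inter> C = {}"
    using kneser_coset[OF C D CD DC Q_def] cQ c by auto
  have "c +o ?K \<subseteq> D" using c by (intro coset_subset) auto
  moreover have "c +o ?K \<subseteq> Q" unfolding Q_def using KM by (rule set_plus_mono)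
  ultimately have "card (c +o ?K) \<le> card (D - C)" using QC D(1) by (intro card_mono) auto
  then show ?thesis using CD by (simp add: card_elt_set_plus)
qed

text \<open>Common periods of \<open>C\<close> and \<open>D\<close> are periods of the union. A
  counterexample therefore satisfies the hypotheses of \<open>kneser_union_aux\<close> in both
  orders, and the two conclusions contradict each other.\<close>

lemma kneser_union:
  fixes C D :: "'a::ab_group_add set"
  assumes C: "finite C" "C \<noteq> {}" and D: "finite D" "D \<noteq> {}"
    and n: "n \<le> card C + card (stab C)" "n \<le> card D + card (stab D)"
  shows "n \<le> card (C \<union> D) + card (stab (C \<union> D))"
proof (cases "C \<subseteq> D \<or> D \<subseteq> C")
  case True
  then show ?thesis using n by (auto simp: Un_absorb1 Un_absorb2)
next
  case False
  let ?n = "card (stab C \<inter> stab D)"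
  have "stab C \<inter> stab D \<subseteq> stab (C \<union> D)" by (auto simp: stab_def)
  then have le: "?n \<le> card (stab (C \<union> D))" using C D by (intro card_mono finite_stab) auto
  have 1: "card (C \<union> D) = card C + card (D - C)"
    using card_Un_disjoint[of C "D - C"] C(1) D(1) by simp
  have 2: "card (C \<union> D) = card D + card (C - D)"
    using card_Un_disjoint[of D "C - D"] C(1) D(1) by (simp add: Un_commute)
  show ?thesis
  proof (rule ccontr)
    assume "\<not> ?thesis"
    then have CD: "card (D - C) + ?n < card (stab C)" and DC: "card (C - D) + ?n < card (stab D)"
      using n le 1 2 by linarith+
    obtain c where "c \<in> D - C" using False by blast
    from kneser_union_aux[OF C D CD DC this] have "card (stab D) < card (stab C)" .
    moreover obtain d where "d \<in> C - D" using False by blast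
    from kneser_union_aux[OF D C _ _ this] have "card (stab C) < card (stab D)"
      using CD DC by (simp add: Int_commute)
    ultimately show False by simp
  qed
qed

lemma kneser_Union:
  assumes "finite F" "F \<noteq> {}"
    and "\<And>C. C \<in> F \<Longrightarrow> finite C \<and> C \<noteq> {} \<and> n \<le> card C + card (stab C)"
  shows "n \<le> card (\<Union>F) + card (stab (\<Union>F))"
  using assms
proof (induction F rule: finite_ne_induct)
  case (insert C F)
  have "n \<le> card (C \<union> \<Union>F) + card (stab (C \<union> \<Union>F))"
    by (rule kneser_union) (use insert in auto)
  then show ?case by simp
qed simp

section \<open>Dyson transforms and Kneser's theorem\<close>

text \<open>The transform moves elements of \<open>B\<close>, shifted by \<open>e - b\<close>, into
  \<open>A\<close>. It preserves the sum of the sizes, does not enlarge the sumset, and keeps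
  \<open>b\<close> in \<open>B\<close> because \<open>b\<close> is shifted to \<open>e\<close>. When
  no choice of \<open>e\<close> shrinks \<open>B\<close>, all of \<open>B - b\<close> stabilises
  \<open>A\<close>, and the translate of \<open>A\<close> by \<open>b\<close> is the required
  set.\<close>

lemma dyson_transform:
  fixes A B :: "'a::ab_group_add set"
  assumes "finite A" "finite B" "a \<in> A" "b \<in> B"
  shows "\<exists>C \<subseteq> A + B. a + b \<in> C \<and> card A + card B \<le> card C + card (stab C)"
  using assms
proof (induction "card B" arbitrary: A B rule: less_induct)
  case less
  show ?case
  proof (cases "\<forall>e\<in>A. \<forall>y\<in>B. y + e - b \<in> A")
    case True
    define C where "C = (\<lambda>x. x + b) ` A"
    have CA: "card C = card A" unfolding C_def by (intro card_image) (simp add: inj_on_def)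
    have "(\<lambda>y. y - b) ` B \<subseteq> stab C"
    proof clarify
      fix y assume y: "y \<in> B"
      show "y - b \<in> stab C"
      proof (rule closed_imp_stab)
        show "finite C" using less.prems(1) by (simp add: C_def)
      next
        fix x assume "x \<in> C"
        then obtain e where e: "e \<in> A" "x = e + b" by (auto simp: C_def)
        have "(y - b) + x = (y + e - b) + b" by (simp add: e)
        then show "(y - b) + x \<in> C"
          unfolding C_def using True e(1) y by (intro image_eqI[where x = "y + e - b"]) auto
      qed
    qed
    then have "card ((\<lambda>y. y - b) ` B) \<le> card (stab C)"
      using less.prems by (intro card_mono finite_stab) (auto simp: C_def)
    moreover have "card ((\<lambda>y. y - b) ` B) = card B" by (intro card_image) (simp add: inj_on_def)
    moreover have "C \<subseteq> A + B" unfolding C_def using less.prems(4) by (simp add: image_subset_iff set_plus_intro)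
    moreover have "a + b \<in> C" unfolding C_def using less.prems(3) by (rule imageI)
    ultimately show ?thesis using CA by (intro exI[of _ C]) simp
  next
    case False
    then obtain e y0 where e: "e \<in> A" and y0: "y0 \<in> B" "y0 + e - b \<notin> A" by blast
    define A' where "A' = A \<union> (\<lambda>y. y + e - b) ` B"
    define B' where "B' = {y\<in>B. y + e - b \<in> A}"
    have "B' \<subset> B" using y0 by (auto simp: B'_def)
    then have "card B' < card B" using less.prems by (intro psubset_card_mono)
    moreover have "finite A'" "finite B'" "a \<in> A'" "b \<in> B'"
      using less.prems e by (auto simp: A'_def B'_def)
    ultimately obtain C where C: "C \<subseteq> A' + B'" "a + b \<in> C" "card A' + card B' \<le> card C + card (stab C)"
      using less.hyps by blast
    have "A' + B' \<subseteq> A + B"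
    proof
      fix x assume "x \<in> A' + B'"
      then obtain p q where pq: "x = p + q" "p \<in> A'" "q \<in> B'" by (elim set_plus_elim) blast
      show "x \<in> A + B"
      proof (cases "p \<in> A")
        case True
        moreover have "q \<in> B" using pq(3) by (simp add: B'_def)
        ultimately show ?thesis unfolding pq(1) by (rule set_plus_intro)
      next
        case False
        then obtain y where y: "y \<in> B" "p = y + e - b" using pq by (auto simp: A'_def)
        \<comment> \<open>The shift is traded between the summands: \<open>q\<close> stayed in
          \<open>B'\<close> exactly because \<open>q + e - b \<in> A\<close>.\<close>
        have eq: "x = (q + e - b) + y" by (simp add: pq y algebra_simps)
        have "q + e - b \<in> A" using pq(3) by (simp add: B'_def)
        then show ?thesis unfolding eq using y(1) by (rule set_plus_intro)
      qed
    qed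
    \<comment> \<open>The shifts of \<open>B'\<close> already lie in \<open>A\<close>, so
      \<open>A\<close> gains exactly as many elements as \<open>B\<close> loses.\<close>
    moreover have "card A' + card B' = card A + card B"
    proof -
      have inj: "inj_on (\<lambda>y. y + e - b) Y" for Y by (simp add: inj_on_def)
      have "A' = A \<union> (\<lambda>y. y + e - b) ` (B - B')" by (auto simp: A'_def B'_def)
      then have "card A' = card A + card ((\<lambda>y. y + e - b) ` (B - B'))"
        using less.prems by (subst card_Un_disjoint[symmetric]) (auto simp: B'_def)
      also have "card ((\<lambda>y. y + e - b) ` (B - B')) = card (B - B')" using inj by (rule card_image)
      also have "card (B - B') = card B - card B'"
        using \<open>B' \<subset> B\<close> \<open>finite B'\<close> by (intro card_Diff_subset) auto
      finally show ?thesis using \<open>card B' < card B\<close> by simp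
    qed
    ultimately show ?thesis using C by (intro exI[of _ C]) auto
  qed
qed

text \<open>The sets supplied by \<open>dyson_transform\<close> for all pairs \<open>(a, b)\<close>
  cover \<open>A + B\<close>, and \<open>kneser_Union\<close> carries their inequality over to the
  union.\<close>

theorem kneser:
  fixes A B :: "'a::ab_group_add set"
  assumes "finite A" "finite B" "A \<noteq> {}" "B \<noteq> {}"
  shows "card A + card B \<le> card (A + B) + card (stab (A + B))"
proof -
  define F where "F = {C. C \<subseteq> A + B \<and> C \<noteq> {} \<and> card A + card B \<le> card C + card (stab C)}"
  have fin: "finite (A + B)" using assms by (simp add: finite_set_plus)
  have F: "finite F" by (rule finite_subset[of _ "Pow (A + B)"]) (auto simp: F_def fin)
  have "x \<in> \<Union>F" if x: "x \<in> A + B" for x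
  proof -
    obtain a b where ab: "a \<in> A" "b \<in> B" "x = a + b" using x by (elim set_plus_elim) blast
    from dyson_transform[OF assms(1,2) ab(1,2)] show ?thesis by (auto simp: F_def ab(3))
  qed
  then have U: "\<Union>F = A + B" by (auto simp: F_def)
  have "A + B \<noteq> {}" using assms by auto
  then have "F \<noteq> {}" using U by auto
  then have "card A + card B \<le> card (\<Union>F) + card (stab (\<Union>F))"
    using F fin by (intro kneser_Union) (auto simp: F_def intro: finite_subset)
  then show ?thesis by (simp add: U)
qed

text \<open>Filling \<open>A\<close> and \<open>B\<close> up to full cosets of \<open>H\<close>
  leaves the sumset unchanged, so \<open>kneser\<close> applies to the larger sets.\<close>

corollary kneser_periodic:
  fixes A B :: "'a::ab_group_add set"
  assumes "finite A" "finite B" "A \<noteq> {}" "B \<noteq> {}"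
  defines "H \<equiv> stab (A + B)"
  shows "card (A + H) + card (B + H) \<le> card (A + B) + card H"
proof -
  have H: "add_subgroup H" "finite H" "H \<noteq> {}"
    using assms add_subgroup_zero[OF add_subgroup_stab[of "A + B"]]
    by (auto simp: H_def add_subgroup_stab intro!: finite_stab finite_set_plus)
  have eq: "(A + H) + (B + H) = A + B"
  proof -
    have "(A + H) + (B + H) = (A + B) + (H + H)" by (simp add: add.assoc add.left_commute)
    then show ?thesis by (simp add: add_subgroup_plus_self[OF H(1)]) (simp add: H_def stab_plus)
  qed
  have "A + H \<noteq> {}" "B + H \<noteq> {}" using assms(3,4) H(3) by auto
  then have "card (A + H) + card (B + H) \<le> card (A + B) + card (stab (A + B))"
    using kneser[of "A + H" "B + H"] assms(1,2) H(2) unfolding eq by (simp add: finite_set_plus)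
  then show ?thesis by (simp add: H_def)
qed

section \<open>The Lev--Smeliansky theorem\<close>

text \<open>
  Integers modulo a variable \<open>l\<close> do not form a type. They are embedded into the rationals modulo 1
  by \<open>x \<mapsto> x / l\<close>, so that Kneser's theorem applies.
\<close>

quotient_type qz = rat / "\<lambda>x y. x - y \<in> \<int>"
proof (rule equivpI)
  show "reflp (\<lambda>x y :: rat. x - y \<in> \<int>)" by (simp add: reflp_def)
  show "symp (\<lambda>x y :: rat. x - y \<in> \<int>)"
  proof (rule sympI)
    fix x y :: rat assume "x - y \<in> \<int>"
    then have "- (x - y) \<in> \<int>" by (rule Ints_minus)
    then show "y - x \<in> \<int>" by simp
  qed
  show "transp (\<lambda>x y :: rat. x - y \<in> \<int>)"
  proof (rule transpI)
    fix x y z :: rat assume "x - y \<in> \<int>" "y - z \<in> \<int>"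
    then have "(x - y) + (y - z) \<in> \<int>" by (rule Ints_add)
    then show "x - z \<in> \<int>" by simp
  qed
qed

instantiation qz :: ab_group_add
begin

lift_definition zero_qz :: qz is 0 .

lift_definition plus_qz :: "qz \<Rightarrow> qz \<Rightarrow> qz" is "(+)"
proof -
  fix x y u v :: rat assume "x - y \<in> \<int>" "u - v \<in> \<int>"
  then have "(x - y) + (u - v) \<in> \<int>" by (rule Ints_add)
  then show "x + u - (y + v) \<in> \<int>" by (simp add: algebra_simps)
qed

lift_definition uminus_qz :: "qz \<Rightarrow> qz" is "uminus"
proof -
  fix x y :: rat assume "x - y \<in> \<int>"
  then have "- (x - y) \<in> \<int>" by (rule Ints_minus)
  then show "- x - - y \<in> \<int>" by simp
qed

lift_definition minus_qz :: "qz \<Rightarrow> qz \<Rightarrow> qz" is "(-)"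
proof -
  fix x y u v :: rat assume "x - y \<in> \<int>" "u - v \<in> \<int>"
  then have "(x - y) - (u - v) \<in> \<int>" by (rule Ints_diff)
  then show "x - u - (y - v) \<in> \<int>" by (simp add: algebra_simps)
qed

instance
  by standard (transfer; simp add: algebra_simps)+

end

lift_definition residue :: "int \<Rightarrow> int \<Rightarrow> qz" is "\<lambda>l x. of_int x / of_int l" .

lemma residue_add: "residue l (x + y) = residue l x + residue l y"
  by transfer (simp add: add_divide_distrib)

lemma residue_diff: "residue l (x - y) = residue l x - residue l y"
  by transfer (simp add: diff_divide_distrib)

lemma residue_eq_iff:
  assumes "l > 0"
  shows "residue l x = residue l y \<longleftrightarrow> l dvd x - y"
proof -
  have "(of_int x / of_int l - of_int y / of_int l :: rat) \<in> \<int> \<longleftrightarrow> l dvd x - y"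
  proof
    assume "(of_int x / of_int l - of_int y / of_int l :: rat) \<in> \<int>"
    then obtain z where "(of_int x / of_int l - of_int y / of_int l :: rat) = of_int z"
      by (elim Ints_cases)
    then have "(of_int (x - y) :: rat) = of_int (l * z)"
      using assms by (simp add: field_simps)
    then have "x - y = l * z" by (simp only: of_int_eq_iff)
    then show "l dvd x - y" by simp
  next
    assume "l dvd x - y"
    then obtain z where "x - y = l * z" by blast
    then have "(of_int x - of_int y :: rat) = of_int l * of_int z" by (metis of_int_diff of_int_mult)
    then have "(of_int x / of_int l - of_int y / of_int l :: rat) = of_int z"
      using assms by (simp add: field_simps)
    then show "(of_int x / of_int l - of_int y / of_int l :: rat) \<in> \<int>" by simp
  qed
  then show ?thesis by transfer
qed

lemma residue_image_plus: "residue l ` (A + B) = residue l ` A + residue l ` B"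
proof (intro equalityI subsetI)
  fix z assume "z \<in> residue l ` (A + B)"
  then obtain a b where ab: "a \<in> A" "b \<in> B" "z = residue l (a + b)" by (auto elim!: set_plus_elim)
  show "z \<in> residue l ` A + residue l ` B"
    unfolding ab(3) residue_add using ab(1,2) by (intro set_plus_intro imageI)
next
  fix z assume "z \<in> residue l ` A + residue l ` B"
  then obtain x y where xy: "x \<in> residue l ` A" "y \<in> residue l ` B" "z = x + y"
    by (elim set_plus_elim) blast
  then obtain a b where ab: "a \<in> A" "b \<in> B" "z = residue l (a + b)"
    by (auto simp: residue_add)
  show "z \<in> residue l ` (A + B)"
    unfolding ab(3) using ab(1,2) by (intro imageI set_plus_intro)
qed

lemma inj_on_residue:
  assumes "l > 0"
  shows "inj_on (residue l) {m..<m + l}"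
proof (rule inj_onI)
  fix x y assume xy: "x \<in> {m..<m + l}" "y \<in> {m..<m + l}" "residue l x = residue l y"
  then have "l dvd x - y" using assms by (simp add: residue_eq_iff)
  moreover have "\<bar>x - y\<bar> < l" using xy by auto
  ultimately show "x = y" using dvd_imp_le_int[of "x - y" l] by fastforce
qed

section \<open>Subgroups of the integers and elementary sumset bounds\<close>

lemma add_subgroup_mult:
  fixes G :: "int set"
  assumes G: "add_subgroup G" and x: "x \<in> G"
  shows "z * x \<in> G"
proof (induction z rule: int_induct[where k = 0])
  case base
  show ?case using G by (simp add: add_subgroup_zero)
next
  case (step1 z)
  then show ?case using add_subgroup_add[OF G _ x, of "z * x"] by (simp add: algebra_simps)
next
  case (step2 z)
  then show ?case using add_subgroup_diff[OF G _ x, of "z * x"] by (simp add: algebra_simps)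
qed

text \<open>Bezout's identity, one element at a time. For \<open>Gcd A = 1\<close> it shows that a
  subgroup containing \<open>A\<close> contains all integers.\<close>

lemma add_subgroup_Gcd:
  fixes G :: "int set"
  assumes G: "add_subgroup G" and A: "finite A" "A \<subseteq> G"
  shows "Gcd A \<in> G"
  using A
proof (induction A rule: finite_induct)
  case empty
  show ?case using G by (simp add: add_subgroup_zero)
next
  case (insert a A)
  obtain u v where uv: "u * a + v * Gcd A = gcd a (Gcd A)" using bezout_int by blast
  have "u * a + v * Gcd A \<in> G"
    using insert by (intro add_subgroup_add[OF G] add_subgroup_mult[OF G]) auto
  then show ?case by (simp add: uv)
qed

text \<open>A positive period would push the maximum of a finite set out of it, so the stabiliser in
  Kneser's theorem is trivial.\<close>

lemma card_plus_int:
  fixes X Y :: "int set"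
  assumes "finite X" "finite Y" "X \<noteq> {}" "Y \<noteq> {}"
  shows "card X + card Y \<le> card (X + Y) + 1"
proof -
  define C where "C = X + Y"
  have C: "finite C" "C \<noteq> {}" using assms by (auto simp: C_def finite_set_plus)
  have le: "h \<le> 0" if "h \<in> stab C" for h
    using stabD[OF that, of "Max C"] Max_in[OF C] Max_ge[OF C(1), of "h + Max C"] by simp
  have "stab C \<subseteq> {0}"
  proof
    fix h assume "h \<in> stab C"
    then show "h \<in> {0}" using le[of h] le[of "- h"] add_subgroup_uminus[OF add_subgroup_stab] by force
  qed
  then have "card (stab C) \<le> 1" using card_mono[of "{0}" "stab C"] by simp
  then show ?thesis using kneser[OF assms] by (simp add: C_def)
qed

text \<open>\<open>X + H\<close> contains both \<open>X\<close> and the full coset of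
  \<open>a\<close>; the last term is their overlap.\<close>

lemma card_plus_subgroup:
  fixes X H :: "'a::ab_group_add set"
  assumes "finite X" "finite H" "0 \<in> H" "a \<in> X"
  shows "card X + card H \<le> card (X + H) + card (X \<inter> (a +o H))"
proof -
  have aH: "finite (a +o H)" "card (a +o H) = card H"
    using assms(2) by (auto simp: card_elt_set_plus finite_elt_set_plus)
  have "X \<union> (a +o H) \<subseteq> X + H"
    using assms set_zero_plus2[of H X] set_plus_mono3[of a X H] by (simp add: add.commute)
  then have "card (X \<union> (a +o H)) \<le> card (X + H)"
    using assms by (intro card_mono finite_set_plus)
  then show ?thesis using card_Un_Int[OF assms(1) aH(1)] aH(2) by linarith
qed

section \<open>Sumsets and residues modulo \<open>l\<close>\<close>

definition double_residues :: "int \<Rightarrow> int set \<Rightarrow> qz set" where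
  "double_residues l S = residue l ` (S \<inter> {0..<l}) \<inter> residue l ` (S \<inter> {l..<2 * l})"

text \<open>\<open>residue l\<close> is injective on each half of \<open>{0..<2 * l}\<close>, so
  this is inclusion-exclusion for the images of the two halves of \<open>S\<close>.\<close>

lemma card_double_residues:
  assumes l: "l > 0" and S: "S \<subseteq> {0..<2 * l}"
  shows "card S = card (residue l ` S) + card (double_residues l S)"
proof -
  let ?L = "S \<inter> {0..<l}" and ?U = "S \<inter> {l..<2 * l}"
  have fin: "finite S" using S by (rule finite_subset) simp
  have eq: "S = ?L \<union> ?U" using S by auto
  have "card S = card ?L + card ?U"
    by (subst eq, rule card_Un_disjoint) (use fin in auto)
  moreover have "card (residue l ` ?L) = card ?L"
    by (rule card_image) (rule inj_on_subset[OF inj_on_residue[OF l, of 0]], auto)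
  moreover have "card (residue l ` ?U) = card ?U"
    by (rule card_image) (rule inj_on_subset[OF inj_on_residue[OF l, of l]], auto)
  moreover have "residue l ` S = residue l ` ?L \<union> residue l ` ?U" by (subst eq) (rule image_Un)
  ultimately show ?thesis
    using card_Un_Int[of "residue l ` ?L" "residue l ` ?U"] fin by (simp add: double_residues_def)
qed

text \<open>Let \<open>H\<close> be the stabiliser of the sumset of residues. If that sumset stays
  inside \<open>?B + H\<close>, it is everything, and the double residues from \<open>B\<close> give
  the first alternative. Otherwise some coset of \<open>H\<close> in the sumset avoids
  \<open>?B\<close>; whatever Kneser's bound loses because \<open>A\<close> and \<open>B\<close>
  fill their cosets only partly is recovered as double residues in this coset.\<close>

theorem lev_smeliansky:
  fixes A B :: "int set" and l :: int
  assumes l: "l > 0" and A: "A \<subseteq> {0..l}" "0 \<in> A" "l \<in> A" "Gcd A = 1"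
    and B: "B \<subseteq> {0..<l}" "B \<noteq> {}"
  shows "l + int (card B) \<le> int (card (A + B)) \<or>
    card A + 2 * card B \<le> card (A + B) + 2"
proof -
  let ?p = "residue l"
  let ?A = "?p ` A" and ?B = "?p ` B"
  have finA: "finite A" and finB: "finite B"
    using finite_subset[OF A(1)] finite_subset[OF B(1)] by simp_all
  have p0: "?p 0 = 0" using residue_diff[of l 0 0] by simp
  have pl: "?p l = 0" using residue_eq_iff[OF l, of l 0] p0 by simp
  define H where "H = stab (?A + ?B)"
  have H: "add_subgroup H" "0 \<in> H" by (simp_all add: H_def add_subgroup_stab add_subgroup_zero)
  obtain b0 where "b0 \<in> B" using B(2) by blast
  then have "?p 0 + ?p b0 \<in> ?A + ?B" using A(2) by (intro set_plus_intro imageI)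
  then have "?A + ?B \<noteq> {}" by (rule ex_in_conv[THEN iffD1, OF exI])
  then have finH: "finite H" unfolding H_def using finA finB by (intro finite_stab finite_set_plus) auto
  have S: "A + B \<subseteq> {0..<2 * l}"
  proof
    fix z assume "z \<in> A + B"
    then obtain x y where "x \<in> A" "y \<in> B" "z = x + y" by (elim set_plus_elim) blast
    moreover from this have "x \<in> {0..l}" "y \<in> {0..<l}" using A(1) B(1) by auto
    ultimately show "z \<in> {0..<2 * l}" by auto
  qed
  have cS: "card (A + B) = card (?A + ?B) + card (double_residues l (A + B))"
    using card_double_residues[OF l S] by (simp add: residue_image_plus)
  have finT: "finite (double_residues l (A + B))"
    using finA finB by (simp add: double_residues_def finite_set_plus)
  \<comment> \<open>Since 0 and \<open>l\<close> lie in \<open>A\<close>, both \<open>b\<close> and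
    \<open>l + b\<close> are sums.\<close>
  have BT: "?B \<subseteq> double_residues l (A + B)"
  proof
    fix y assume "y \<in> ?B"
    then obtain b where b: "b \<in> B" "y = ?p b" by blast
    have "b \<in> A + B" using set_zero_plus2[OF A(2), of B] b(1) by blast
    moreover have "l + b \<in> A + B" using A(3) b(1) by (rule set_plus_intro)
    moreover have "b \<in> {0..<l}" "l + b \<in> {l..<2 * l}" using B(1) b(1) by auto
    moreover have "?p (l + b) = y" using b by (simp add: residue_add pl)
    ultimately show "y \<in> double_residues l (A + B)"
      unfolding double_residues_def using b(2) by (intro IntI image_eqI[where x = b] image_eqI[where x = "l + b"]) auto
  qed
  have cB: "card ?B = card B"
    by (rule card_image) (rule inj_on_subset[OF inj_on_residue[OF l, of 0]], use B in auto)
  have injA: "inj_on ?p (A - {l})"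
    by (rule inj_on_subset[OF inj_on_residue[OF l, of 0]]) (use A in auto)
  have "?p l \<in> ?p ` (A - {l})" using A(2) l p0 pl by (intro image_eqI[where x = 0]) auto
  then have eqA: "?A = ?p ` (A - {l})"
    using insert_absorb image_insert[of ?p l "A - {l}"] A(3) by (simp add: insert_absorb)
  have "card (A - {l}) + 1 = card A" using card.remove[OF finA A(3)] by simp
  \<comment> \<open>The elements 0 and \<open>l\<close> of \<open>A\<close> collapse to one
    residue.\<close>
  then have cA: "card ?A + 1 = card A" unfolding eqA by (simp add: card_image[OF injA])
  show ?thesis
  proof (cases "?A + ?B \<subseteq> ?B + H")
    case True
    \<comment> \<open>then \<open>?B + H\<close> is invariant under \<open>?A\<close>, which generates all residues\<close>
    define Y where "Y = ?B + H"
    have finY: "finite Y" using finB finH by (simp add: Y_def finite_set_plus)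
    have "?p x \<in> stab Y" if "x \<in> A" for x
    proof (rule closed_imp_stab[OF finY])
      fix y assume "y \<in> Y"
      then have "?p x + y \<in> ?A + Y" using that by blast
      also have "?A + Y = (?A + ?B) + H" by (simp add: Y_def add.assoc)
      also have "\<dots> \<subseteq> (?B + H) + H" using True order_refl by (rule set_plus_mono2)
      also have "\<dots> = Y" by (simp add: Y_def add.assoc add_subgroup_plus_self[OF H(1)])
      finally show "?p x + y \<in> Y" .
    qed
    moreover have G: "add_subgroup {x. ?p x \<in> stab Y}"
      using add_subgroup_stab[of Y] by (simp add: add_subgroup_def p0 residue_diff)
    ultimately have "1 \<in> {x. ?p x \<in> stab Y}"
      using add_subgroup_Gcd[OF G finA] A(4) by auto
    from add_subgroup_mult[OF G this] have all: "?p x \<in> stab Y" for x by simp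
    obtain b where b: "b \<in> B" using B by blast
    have bY: "?p b \<in> Y" using b set_zero_plus2[OF H(2), of ?B] by (auto simp: Y_def add.commute)
    have "?p x \<in> Y" for x
      using stabD[OF all[of "x - b"], of "?p b"] bY by (simp add: residue_add[symmetric])
    then have "?p ` {0..<l} \<subseteq> Y" by blast
    \<comment> \<open>As 0 is a residue of \<open>A\<close> and \<open>H\<close> stabilises
      \<open>?A + ?B\<close>, the full set \<open>Y\<close> lies in that sumset.\<close>
    also have "Y \<subseteq> ?A + Y" using A(2) p0 set_zero_plus2[of ?A Y] by force
    also have "?A + Y = ?A + ?B" using stab_plus[of "?A + ?B"] by (simp add: Y_def H_def add.assoc)
    finally have "card (?p ` {0..<l}) \<le> card (?A + ?B)"
      using finA finB by (intro card_mono finite_set_plus) auto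
    moreover have "card (?p ` {0..<l}) = nat l"
      using inj_on_residue[OF l, of 0] by (simp add: card_image)
    moreover have "card B \<le> card (double_residues l (A + B))"
      using card_mono[OF finT BT] cB by simp
    ultimately show ?thesis using cS l by linarith
  next
    case False
    then obtain a b where ab: "a \<in> A" "b \<in> B" "?p a + ?p b \<notin> ?B + H"
      by (auto elim!: set_plus_elim)
    \<comment> \<open>the coset of \<open>?p a + ?p b\<close> is disjoint from \<open>?B\<close>, so its double residues are additional\<close>
    define A' where "A' = {x \<in> A - {l}. ?p x - ?p a \<in> H}"
    define B' where "B' = {y \<in> B. ?p y - ?p b \<in> H}"
    let ?c = "?p a + ?p b"
    \<comment> \<open>If \<open>a\<close> is the removed element \<open>l\<close>, then 0 represents
      the same residue.\<close>
    have A'ne: "A' \<noteq> {}"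
    proof (cases "a = l")
      case True
      then have "0 \<in> A'" using A(2) l H(2) p0 pl by (simp add: A'_def)
      then show ?thesis by blast
    qed (use ab H(2) in \<open>auto simp: A'_def\<close>)
    have B'ne: "B' \<noteq> {}" using ab H(2) by (auto simp: B'_def)
    have S': "A' + B' \<subseteq> A + B" by (intro set_plus_mono2) (auto simp: A'_def B'_def)
    have coset: "?p ` (A' + B') \<subseteq> ?c +o H"
    proof -
      have "?p (x + y) - ?c \<in> H" if "x \<in> A'" "y \<in> B'" for x y
        using add_subgroup_add[OF H(1), of "?p x - ?p a" "?p y - ?p b"] that
        by (simp add: A'_def B'_def residue_add algebra_simps)
      then show ?thesis by (auto simp: mem_elt_set_plus elim!: set_plus_elim)
    qed
    have fincH: "finite (?c +o H)" using finH by (rule finite_elt_set_plus)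
    \<comment> \<open>All of \<open>A' + B'\<close> lies over one coset, so its size beyond
      \<open>card H\<close> comes from double residues.\<close>
    have 1: "card (A' + B') \<le> card H + card (double_residues l (A' + B'))"
      using card_double_residues[OF l order_trans[OF S' S]] card_mono[OF fincH coset]
      by (simp add: card_elt_set_plus)
    have T': "double_residues l (A' + B') \<subseteq> double_residues l (A + B)"
      using S' unfolding double_residues_def by blast
    have "double_residues l (A' + B') \<subseteq> ?c +o H"
      using coset unfolding double_residues_def by blast
    moreover have "(?c +o H) \<inter> ?B = {}"
    proof (rule ccontr)
      assume "(?c +o H) \<inter> ?B \<noteq> {}"
      then obtain y where y: "y \<in> ?B" "y \<in> ?c +o H" by blast
      then have "y - ?c \<in> H" by (simp add: mem_elt_set_plus)
      have "?c = y + - (y - ?c)" by simp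
      also have "\<dots> \<in> ?B + H" using y(1) add_subgroup_uminus[OF H(1)] \<open>y - ?c \<in> H\<close>
        by (intro set_plus_intro)
      finally show False using ab(3) by simp
    qed
    ultimately have "card (?B \<union> double_residues l (A' + B')) = card ?B + card (double_residues l (A' + B'))"
      using finB finite_subset[OF T' finT] by (intro card_Un_disjoint) auto
    moreover have "card (?B \<union> double_residues l (A' + B')) \<le> card (double_residues l (A + B))"
      using BT T' finT by (intro card_mono) auto
    ultimately have 2: "card B + card (double_residues l (A' + B')) \<le> card (double_residues l (A + B))"
      by (simp add: cB)
    have finA': "finite A'" and finB': "finite B'" using finA finB by (simp_all add: A'_def B'_def)
    have 3: "card A' + card B' \<le> card (A' + B') + 1"
      using finA' finB' A'ne B'ne by (rule card_plus_int)
    have "?A \<inter> (?p a +o H) \<subseteq> ?p ` A'"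
    proof
      fix y assume "y \<in> ?A \<inter> (?p a +o H)"
      then obtain x where "x \<in> A - {l}" "y = ?p x" "?p x - ?p a \<in> H"
        unfolding eqA by (auto simp: mem_elt_set_plus)
      then show "y \<in> ?p ` A'" by (auto simp: A'_def)
    qed
    then have "card (?A \<inter> (?p a +o H)) \<le> card A'" using finA' by (metis card_image_le card_mono finite_imageI order_trans)
    then have 4: "card ?A + card H \<le> card (?A + H) + card A'"
      using card_plus_subgroup[of ?A H "?p a"] finA finH H ab(1) by fastforce
    have "?B \<inter> (?p b +o H) \<subseteq> ?p ` B'"
      by (auto simp: B'_def mem_elt_set_plus)
    then have "card (?B \<inter> (?p b +o H)) \<le> card B'" using finB' by (metis card_image_le card_mono finite_imageI order_trans)
    then have 5: "card ?B + card H \<le> card (?B + H) + card B'"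
      using card_plus_subgroup[of ?B H "?p b"] finB finH H ab(2) by fastforce
    have 6: "card (?A + H) + card (?B + H) \<le> card (?A + ?B) + card H"
      unfolding H_def using finA finB A B by (intro kneser_periodic) auto
    \<comment> \<open>Facts \<open>4\<close> to \<open>6\<close> bound the residues,
      \<open>1\<close> to \<open>3\<close> the double residues; the terms in \<open>A'\<close>,
      \<open>B'\<close> and \<open>H\<close> cancel. Of the loss of 2, one unit comes from
      \<open>cA\<close> and one from \<open>3\<close>.\<close>
    show ?thesis using 1 2 3 4 5 6 cS cA cB by linarith
  qed
qed

section \<open>Sums of dilates\<close>

lemma dilate_sum_affine:
  fixes c g :: int
  shows "(\<lambda>x. c + g * x) ` A + 2 *o ((\<lambda>x. c + g * x) ` A) = (\<lambda>z. 3 * c + g * z) ` (A + 2 *o A)"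
proof (intro equalityI subsetI)
  fix z assume "z \<in> (\<lambda>x. c + g * x) ` A + 2 *o ((\<lambda>x. c + g * x) ` A)"
  then obtain x y where xy: "x \<in> A" "y \<in> A" "z = (c + g * x) + 2 * (c + g * y)"
    by (auto simp: elt_set_times_def elim!: set_plus_elim)
  then have "z = 3 * c + g * (x + 2 * y)" by (simp add: algebra_simps)
  moreover have "x + 2 * y \<in> A + 2 *o A" using xy(1,2) by (intro set_plus_intro set_times_intro2)
  ultimately show "z \<in> (\<lambda>z. 3 * c + g * z) ` (A + 2 *o A)" by blast
next
  fix z assume "z \<in> (\<lambda>z. 3 * c + g * z) ` (A + 2 *o A)"
  then obtain x y where xy: "x \<in> A" "y \<in> A" "z = 3 * c + g * (x + 2 * y)"
    by (auto simp: elt_set_times_def elim!: set_plus_elim)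
  then have z: "z = (c + g * x) + 2 * (c + g * y)" by (simp add: algebra_simps)
  show "z \<in> (\<lambda>x. c + g * x) ` A + 2 *o ((\<lambda>x. c + g * x) ` A)"
    unfolding z using xy(1,2) by (intro set_plus_intro set_times_intro2 imageI)
qed

lemma card_dilate_sum_affine:
  fixes c g :: int
  assumes "g \<noteq> 0" and "A = (\<lambda>x. c + g * x) ` A'"
  shows "card (A + 2 *o A) = card (A' + 2 *o A')"
  unfolding assms(2) dilate_sum_affine
  by (rule card_image) (use assms(1) in \<open>simp add: inj_on_def\<close>)

text \<open>Writing \<open>x = 2 * (x div 2) + r\<close> gives
  \<open>x + 2 * y = 2 * (y + x div 2) + r\<close>, which turns a dilated sum into an ordinary
  one.\<close>

lemma dilate_sum_parity:
  fixes A :: "int set"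
  assumes r: "r \<in> {0, 1}"
  shows "{x \<in> A. x mod 2 = r} + 2 *o A = (\<lambda>z. 2 * z + r) ` (A + (\<lambda>x. x div 2) ` {x \<in> A. x mod 2 = r})"
proof (intro equalityI subsetI)
  fix z assume "z \<in> {x \<in> A. x mod 2 = r} + 2 *o A"
  then obtain x y where xy: "x \<in> A" "x mod 2 = r" "y \<in> A" "z = x + 2 * y"
    by (auto simp: elt_set_times_def elim!: set_plus_elim)
  then have "z = 2 * (y + x div 2) + r" using div_mult_mod_eq[of x 2] by (simp add: algebra_simps)
  moreover have "y + x div 2 \<in> A + (\<lambda>x. x div 2) ` {x \<in> A. x mod 2 = r}"
    using xy(1-3) by (intro set_plus_intro imageI) auto
  ultimately show "z \<in> (\<lambda>z. 2 * z + r) ` (A + (\<lambda>x. x div 2) ` {x \<in> A. x mod 2 = r})" by blast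
next
  fix z assume "z \<in> (\<lambda>z. 2 * z + r) ` (A + (\<lambda>x. x div 2) ` {x \<in> A. x mod 2 = r})"
  then obtain x y where xy: "x \<in> A" "x mod 2 = r" "y \<in> A" "z = 2 * (y + x div 2) + r"
    by (auto elim!: set_plus_elim)
  then have z: "z = x + 2 * y" using div_mult_mod_eq[of x 2] by (simp add: algebra_simps)
  show "z \<in> {x \<in> A. x mod 2 = r} + 2 *o A"
    unfolding z using xy(1-3) by (intro set_plus_intro set_times_intro2) auto
qed

lemma card_dilate_sum_split:
  fixes A :: "int set"
  assumes "finite A"
  defines "B \<equiv> \<lambda>r. (\<lambda>x. x div 2) ` {x \<in> A. x mod 2 = r}"
  shows "card (A + 2 *o A) = card (A + B 0) + card (A + B 1)"
    and "card A = card (B 0) + card (B 1)"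
proof -
  let ?A = "\<lambda>r. {x \<in> A. x mod 2 = r}"
  have split: "A = ?A 0 \<union> ?A 1" by auto
  have fin: "finite (A + B r)" for r using assms(1) by (simp add: B_def finite_set_plus)
  have "A + 2 *o A = (?A 0 \<union> ?A 1) + 2 *o A" using split by simp
  also have "\<dots> = (?A 0 + 2 *o A) \<union> (?A 1 + 2 *o A)" by (rule Un_set_plus)
  also have "\<dots> = (\<lambda>z. 2 * z + 0) ` (A + B 0) \<union> (\<lambda>z. 2 * z + 1) ` (A + B 1)"
    unfolding B_def by (subst (1 2) dilate_sum_parity) auto
  finally have eq: "A + 2 *o A = (\<lambda>z. 2 * z + 0) ` (A + B 0) \<union> (\<lambda>z. 2 * z + 1) ` (A + B 1)" .
  have "(\<lambda>z. 2 * z + 0) ` (A + B 0) \<inter> (\<lambda>z. 2 * z + 1) ` (A + B 1) = {}"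
    by (auto, presburger)
  then have "card (A + 2 *o A) = card ((\<lambda>z. 2 * z + 0) ` (A + B 0)) + card ((\<lambda>z. 2 * z + 1) ` (A + B 1))"
    unfolding eq using fin by (intro card_Un_disjoint) auto
  then show "card (A + 2 *o A) = card (A + B 0) + card (A + B 1)"
    by (simp add: card_image inj_on_def)
  have cB: "card (B r) = card (?A r)" for r
    unfolding B_def
  proof (rule card_image, rule inj_onI)
    fix x y assume "x \<in> ?A r" "y \<in> ?A r" "x div 2 = y div 2"
    then show "x = y" using div_mult_mod_eq[of x 2] div_mult_mod_eq[of y 2] by simp
  qed
  have "card A = card (?A 0 \<union> ?A 1)" using split by simp
  also have "\<dots> = card (?A 0) + card (?A 1)" using assms(1) by (intro card_Un_disjoint) auto
  finally show "card A = card (B 0) + card (B 1)" by (simp add: cB)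
qed

lemma dilate_sum_bounds:
  fixes A :: "int set"
  assumes l: "l > 0" and A: "A \<subseteq> {0..l}" "0 \<in> A" "l \<in> A" "Gcd A = 1"
  shows "3 * card A \<le> card (A + 2 *o A) + 2"
    and "l + 2 * int (card A) - 1 \<le> int (card (A + 2 *o A)) \<or> 4 * card A \<le> card (A + 2 *o A) + 4"
proof -
  define B where "B = (\<lambda>r. (\<lambda>x. x div 2) ` {x \<in> A. x mod 2 = r})"
  have finA: "finite A" using finite_subset[OF A(1)] by simp
  have card: "card (A + 2 *o A) = card (A + B 0) + card (A + B 1)" "card A = card (B 0) + card (B 1)"
    using card_dilate_sum_split[OF finA] by (simp_all add: B_def)
  \<comment> \<open>Halving brings even \<open>l\<close> itself strictly below \<open>l\<close>, as
    \<open>lev_smeliansky\<close> requires.\<close>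
  have sub: "B r \<subseteq> {0..<l}" for r
  proof
    fix y assume "y \<in> B r"
    then obtain x where "x \<in> A" "y = x div 2" by (auto simp: B_def)
    moreover from this have "0 \<le> x" "x \<le> l" using A(1) by auto
    ultimately show "y \<in> {0..<l}" using l by auto
  qed
  have ne0: "B 0 \<noteq> {}" using A(2) by (auto simp: B_def)
  \<comment> \<open>Without odd elements, 2 would divide \<open>Gcd A = 1\<close>.\<close>
  have ne1: "B 1 \<noteq> {}"
  proof
    assume "B 1 = {}"
    then have "even x" if "x \<in> A" for x using that by (auto simp: B_def even_iff_mod_2_eq_zero)
    then have "2 dvd Gcd A" by (intro Gcd_greatest)
    then show False using A(4) by simp
  qed
  have finB: "finite (B r)" for r using finA by (simp add: B_def)
  have le: "card A + card (B r) \<le> card (A + B r) + 1" if "B r \<noteq> {}" for r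
    using card_plus_int[OF finA finB _ that] A(2) by blast
  show "3 * card A \<le> card (A + 2 *o A) + 2"
    using le[OF ne0] le[OF ne1] card by linarith
  have LS: "l + int (card (B r)) \<le> int (card (A + B r)) \<or> card A + 2 * card (B r) \<le> card (A + B r) + 2"
    if "B r \<noteq> {}" for r
    using lev_smeliansky[OF l A sub that] .
  \<comment> \<open>If the first alternative holds for one parity class, the trivial bound for the
    other completes \<open>l + 2k - 1\<close>, where \<open>k = card A\<close>; otherwise the two
    second alternatives add up to \<open>4k - 4\<close>.\<close>
  show "l + 2 * int (card A) - 1 \<le> int (card (A + 2 *o A)) \<or> 4 * card A \<le> card (A + 2 *o A) + 4"
    using LS[OF ne0] LS[OF ne1] le[OF ne0] le[OF ne1] card by linarith
qed

section \<open>Reduction to normalised sets\<close>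

text \<open>Subtract the minimum and divide by the gcd of the differences. Two distinct elements
  make this gcd positive, and also the new maximum \<open>l\<close>.\<close>

lemma normalize_int_set:
  fixes A :: "int set"
  assumes A: "finite A" "2 \<le> card A"
  obtains A' g l where "g > 0" "l > 0" "A = (\<lambda>x. Min A + g * x) ` A'"
    "A' \<subseteq> {0..l}" "0 \<in> A'" "l \<in> A'" "Gcd A' = 1"
proof -
  let ?D = "(\<lambda>x. x - Min A) ` A"
  define g where "g = Gcd ?D"
  define A' where "A' = (\<lambda>x. (x - Min A) div g) ` A"
  have ne: "A \<noteq> {}" using A by auto
  have "\<exists>x\<in>A. x \<noteq> Min A"
  proof (rule ccontr)
    assume "\<not> ?thesis"
    then have "A \<subseteq> {Min A}" by blast
    then show False using A card_mono[of "{Min A}" A] by simp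
  qed
  then obtain x0 where x0: "x0 \<in> A" "x0 \<noteq> Min A" by blast
  have g0: "g \<noteq> 0" using x0 by (auto simp: g_def)
  moreover have "g \<ge> 0" unfolding g_def by (rule Gcd_int_greater_eq_0)
  ultimately have g: "g > 0" by simp
  have dv: "g * ((x - Min A) div g) = x - Min A" if "x \<in> A" for x
    using that by (simp add: g_def)
  have eq: "A = (\<lambda>x. Min A + g * x) ` A'"
  proof -
    have "(\<lambda>x. Min A + g * x) ` A' = (\<lambda>x. Min A + g * ((x - Min A) div g)) ` A"
      by (simp add: A'_def image_image)
    also have "\<dots> = (\<lambda>x. x) ` A" by (intro image_cong refl) (simp add: dv)
    finally show ?thesis by simp
  qed
  have gA': "(*) g ` A' = ?D"
    unfolding A'_def image_image by (intro image_cong refl) (simp add: dv)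
  have "g = normalize (g * Gcd A')" using Gcd_mult[of g A'] gA' by (simp add: g_def)
  then have "g * Gcd A' = g * 1" using g by (simp add: abs_mult)
  then have Gcd: "Gcd A' = 1" using g by simp
  have finA': "finite A'" using A by (simp add: A'_def)
  have A'0: "0 \<in> A'" unfolding A'_def using Min_in[OF A(1) ne] by (intro image_eqI[of _ _ "Min A"]) auto
  have nonneg: "0 \<le> x" if "x \<in> A'" for x
    using that A(1) g by (auto simp: A'_def pos_imp_zdiv_nonneg_iff)
  define l where "l = Max A'"
  have lA': "l \<in> A'" unfolding l_def using finA' A'0 by (intro Max_in) auto
  have sub: "A' \<subseteq> {0..l}" using nonneg finA' by (auto simp: l_def)
  have "l \<noteq> 0"
  proof
    assume "l = 0"
    then have "A' = {0}" using sub A'0 by auto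
    then show False using Gcd by simp
  qed
  then have "l > 0" using nonneg[OF lA'] by simp
  then show ?thesis using that[OF g _ eq sub A'0 lA' Gcd] by simp
qed

lemma card_arith_prog: "d > 0 \<Longrightarrow> card (arith_prog b d l) = l"
  unfolding arith_prog_def by (subst card_image) (auto simp: inj_on_def)

text \<open>The normalising map preserves both sizes. It sends \<open>{0..l}\<close> to a
  progression with \<open>l + 1\<close> terms and difference \<open>g\<close>; the hypothesis of the
  second part rules out the alternative \<open>4k - 4\<close>.\<close>

lemma dilate_sum_structure:
  fixes A :: "int set"
  assumes A: "finite A" "2 \<le> card A"
  shows "3 * card A \<le> card (A + 2 *o A) + 2"
    and "card (A + 2 *o A) + 4 < 4 * card A \<Longrightarrow>
      \<exists>d l. d > 0 \<and> A \<subseteq> arith_prog (Min A) d l \<and> l + 2 * card A \<le> card (A + 2 *o A) + 2"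
proof -
  obtain A' g l where n: "g > 0" "l > 0" "A = (\<lambda>x. Min A + g * x) ` A'"
    "A' \<subseteq> {0..l}" "0 \<in> A'" "l \<in> A'" "Gcd A' = 1"
    using normalize_int_set[OF A] .
  have F: "card (A + 2 *o A) = card (A' + 2 *o A')"
    using n(1,3) by (intro card_dilate_sum_affine) auto
  have "card ((\<lambda>x. Min A + g * x) ` A') = card A'"
    by (rule card_image) (use n(1) in \<open>simp add: inj_on_def\<close>)
  then have k: "card A = card A'" using n(3) by simp
  note b = dilate_sum_bounds[OF n(2,4-7)]
  show "3 * card A \<le> card (A + 2 *o A) + 2" using b(1) by (simp add: F k)
  assume "card (A + 2 *o A) + 4 < 4 * card A"
  then have "l + 2 * int (card A) - 1 \<le> int (card (A + 2 *o A))" using b(2) by (simp add: F k)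
  then have "nat (l + 1) + 2 * card A \<le> card (A + 2 *o A) + 2" using n(2) by simp
  moreover have "A \<subseteq> arith_prog (Min A) g (nat (l + 1))"
  proof
    fix y assume "y \<in> A"
    then obtain x where x: "x \<in> A'" "y = Min A + g * x" using n(3) by blast
    have "0 \<le> x" "x \<le> l" using x(1) n(4) by auto
    then show "y \<in> arith_prog (Min A) g (nat (l + 1))"
      unfolding arith_prog_def x(2) by (intro image_eqI[of _ _ "nat x"]) (auto simp: mult.commute)
  qed
  ultimately show "\<exists>d l. d > 0 \<and> A \<subseteq> arith_prog (Min A) d l \<and> l + 2 * card A \<le> card (A + 2 *o A) + 2"
    using n(1) by blast
qed

text \<open>For two elements the lower bound \<open>3 * 2 - 2\<close> meets the upper bound 4, the
  number of pairs of summands.\<close>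

lemma small_arith_prog:
  fixes A :: "int set"
  assumes "card A \<in> {1, 2}"
  shows "card (A + 2 *o A) + 2 = 3 * card A" and "\<exists>d > 0. A = arith_prog (Min A) d (card A)"
proof -
  have fin: "finite A" using assms card.infinite by fastforce
  have "card (A + 2 *o A) + 2 = 3 * card A \<and> (\<exists>d > 0. A = arith_prog (Min A) d (card A))"
  proof (cases "card A = 1")
    case True
    then obtain x where "A = {x}" by (auto simp: card_1_singleton_iff)
    moreover have "{x} + 2 *o {x} = {x + 2 * x}" by (simp add: elt_set_times_def set_plus_def)
    ultimately show ?thesis by (auto simp: arith_prog_def lessThan_Suc intro!: exI[of _ 1])
  next
    case False
    then have 2: "card A = 2" using assms by simp
    have "2 *o A = (*) 2 ` A" by (auto simp: elt_set_times_def)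
    then have "card (2 *o A) \<le> 2" "finite (2 *o A)" using 2 fin card_image_le[OF fin, of "(*) 2"] by auto
    then have "card (A + 2 *o A) \<le> 4"
      using card_image_le[of "A \<times> 2 *o A" "\<lambda>(x, y). x + y"] fin 2
      by (simp add: set_plus_image card_cartesian_product)
    then have F: "card (A + 2 *o A) + 2 = 3 * card A" using dilate_sum_structure(1)[OF fin] 2 by simp
    obtain u v where "A = {u, v}" "u \<noteq> v" using 2 by (auto simp: card_2_iff)
    then have "A = {min u v, max u v}" "min u v < max u v" by (auto simp: min_def max_def)
    then obtain x y where xy: "A = {x, y}" "x < y" by blast
    then have "Min A = x" by simp
    moreover have "arith_prog x (y - x) 2 = A"
      by (simp add: xy(1) arith_prog_def lessThan_Suc numeral_2_eq_2 insert_commute)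
    ultimately have "A = arith_prog (Min A) (y - x) (card A)" by (simp only: 2)
    then show ?thesis using F xy(2) by (intro conjI exI[of _ "y - x"]) simp_all
  qed
  then show "card (A + 2 *o A) + 2 = 3 * card A" "\<exists>d > 0. A = arith_prog (Min A) d (card A)" by auto
qed

theorem theorem4:
  fixes A :: "int set" and a :: "nat \<Rightarrow> int" and k :: nat
  assumes "A = a ` {..<k}"
    and "strict_mono_on {..<k} a"
    and "k = card A"
    and "k \<ge> 1"
  shows
    "(k \<le> 2 \<longrightarrow>
        int (card (A + 2 *o A)) = 3 * int k - 2 \<and> is_arith_prog_of_size A k)
   \<and> (\<forall>h :: int.
        k \<ge> 3 \<and> int (card (A + 2 *o A)) = (3 * int k - 2) + h
              \<and> (3 * int k - 2) + h < 4 * int k - 4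
        \<longrightarrow> h \<ge> 0 \<and> int (card (A + 2 *o A)) \<ge> 3 * int k - 2
          \<and> (\<exists>(d :: int) (l :: nat) P. d > 0 \<and> P = arith_prog (a 0) d l \<and> A \<subseteq> P
               \<and> int (card P) \<le> int k + h
               \<and> int k + h = int (card (A + 2 *o A)) - 2 * int k + 2
               \<and> int (card (A + 2 *o A)) - 2 * int k + 2 \<le> 2 * int k - 3))
   \<and> (int (card (A + 2 *o A)) = 3 * int k - 2 \<longrightarrow>
        (\<exists>d > 0. A = arith_prog (a 0) d k))"
proof -
  have fin: "finite A" by (simp add: assms(1))
  have min: "Min A = a 0"
  proof (rule Min_eqI[OF fin])
    show "a 0 \<in> A" using assms(1,4) by auto
    fix y assume "y \<in> A"
    then obtain i where "i < k" "y = a i" using assms(1) by auto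
    then show "a 0 \<le> y"
      using strict_mono_on_leD[OF assms(2), of 0 i] assms(4) by simp
  qed
  note small = small_arith_prog[of A, unfolded min assms(3)[symmetric]]
  have low: "3 * int k - 2 \<le> int (card (A + 2 *o A))" if "k \<ge> 3"
    using dilate_sum_structure(1)[OF fin] that assms(3) by linarith
  \<comment> \<open>When the sumset has size \<open>3k - 2 + h\<close>, this bound on
    \<open>l\<close> is \<open>k + h\<close>.\<close>
  have P: "\<exists>d l. d > 0 \<and> A \<subseteq> arith_prog (a 0) d l \<and> card (arith_prog (a 0) d l) = l
      \<and> int l \<le> int (card (A + 2 *o A)) - 2 * int k + 2"
    if k: "k \<ge> 3" and lt: "int (card (A + 2 *o A)) < 4 * int k - 4"
  proof -
    have "2 \<le> card A" "card (A + 2 *o A) + 4 < 4 * card A" using k lt assms(3) by linarith+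
    from dilate_sum_structure(2)[OF fin this] obtain d l where
      "d > 0" "A \<subseteq> arith_prog (a 0) d l" "l + 2 * card A \<le> card (A + 2 *o A) + 2"
      by (auto simp: min)
    then show ?thesis using card_arith_prog[of d "a 0" l] assms(3) by (intro exI[of _ d] exI[of _ l]) auto
  qed
  have a: "int (card (A + 2 *o A)) = 3 * int k - 2 \<and> is_arith_prog_of_size A k" if "k \<le> 2"
  proof -
    have "k \<in> {1, 2}" using that assms(4) by auto
    then show ?thesis using small by (auto simp: is_arith_prog_of_size_def)
  qed
  have b: "h \<ge> 0 \<and> int (card (A + 2 *o A)) \<ge> 3 * int k - 2
          \<and> (\<exists>(d :: int) (l :: nat) P. d > 0 \<and> P = arith_prog (a 0) d l \<and> A \<subseteq> P
               \<and> int (card P) \<le> int k + h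
               \<and> int k + h = int (card (A + 2 *o A)) - 2 * int k + 2
               \<and> int (card (A + 2 *o A)) - 2 * int k + 2 \<le> 2 * int k - 3)"
    if h: "k \<ge> 3" "int (card (A + 2 *o A)) = (3 * int k - 2) + h" "(3 * int k - 2) + h < 4 * int k - 4" for h
  proof -
    obtain d l where dl: "d > 0" "A \<subseteq> arith_prog (a 0) d l" "card (arith_prog (a 0) d l) = l"
      "int l \<le> int (card (A + 2 *o A)) - 2 * int k + 2"
      using P h by auto
    then show ?thesis using low h
      by (intro conjI exI[of _ d] exI[of _ l] exI[of _ "arith_prog (a 0) d l"]) auto
  qed
  have c: "\<exists>d > 0. A = arith_prog (a 0) d k" if F: "int (card (A + 2 *o A)) = 3 * int k - 2"
  proof (cases "k \<le> 2")
    case True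
    then have "k \<in> {1, 2}" using assms(4) by auto
    then show ?thesis using small by blast
  next
    case False
    \<comment> \<open>For \<open>k \<ge> 3\<close> one has \<open>3k - 2 < 4k - 4\<close>, so
      \<open>P\<close> applies with \<open>l \<le> k\<close>, and \<open>A\<close> must fill the
      progression.\<close>
    then obtain d l where dl: "d > 0" "A \<subseteq> arith_prog (a 0) d l" "card (arith_prog (a 0) d l) = l"
      "int l \<le> int (card (A + 2 *o A)) - 2 * int k + 2"
      using P F by auto
    have fP: "finite (arith_prog (a 0) d l)" by (simp add: arith_prog_def)
    have "k \<le> l" using card_mono[OF fP dl(2)] dl(3) assms(3) by simp
    then have "l = k" using dl(4) F by linarith
    then have "A = arith_prog (a 0) d k"
      using card_subset_eq[OF fP dl(2)] dl(3) assms(3) by simp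
    then show ?thesis using dl(1) by blast
  qed
  show ?thesis using a b c by blast
qed

end
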